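(* Let $X$ be any uniformly locally finite metric space. Then the $\mathrm{C}^*$-algebra $\prod_{n} \mathbb{M}_n$ does not embed into the uniform Roe algebra $\mathrm{C}^*_{\mathrm{u}}[X]$; that is, there is no (possibly non-unital) injective $*$-homomorphism $\prod_{n} \mathbb{M}_n \to \mathrm{C}^*_{\mathrm{u}}[X]$.
   Context: A (discrete) metric space $X$ is uniformly locally finite (ulf, also called of bounded geometry) if $N_X(R) := \sup\{ |\mathrm{Ball}(x,R)| : x\in X\} < \infty$ for every $R>0$, where $\mathrm{Ball}(x,R) := \{y\in X : \mathrm{dist}(y,x)\le R\}$. Let $\mathbb{B}(\ell_2X)$ be the $\mathrm{C}^*$-algebra of bounded operators on the complex Hilbert space $\ell_2X$, with canonical orthonormal basis $(\delta_x)_{x\in X}$. For $R>0$ put $$\mathbb{C}_{\mathrm{u}}^R[X] := \{u\in\mathbb{B}(\ell_2X) : \langle u\delta_x,\delta_y\rangle = 0 \text{ whenever } \mathrm{dist}(x,y)>R\},$$ the set of operators with propagation at most $R$. The uniform Roe algebra $\mathrm{C}^*_{\mathrm{u}}[X]$ is the operator-norm closure in $\mathbb{B}(\ell_2X)$ of the $*$-algebra $\bigcup_{R>0}\mathbb{C}_{\mathrm{u}}^R[X]$. $\mathbb{M}_n$ denotes the $\mathrm{C}^*$-algebra of $n\times n$ complex matrices, and $\prod_n\mathbb{M}_n$ denotes the $\ell_\infty$-direct sum of the $\mathbb{M}_n$, $n=1,2,\dots$, i.e. the $\mathrm{C}^*$-algebra of all norm-bounded sequences $(a_n)_n$ with $a_n\in\mathbb{M}_n$,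 with the supremum norm and coordinatewise operations. An embedding of $\mathrm{C}^*$-algebras is an injective $*$-homomorphism, not required to be unital. *)

theory Defs
  imports
    "HOL-Analysis.Analysis"
    "Jordan_Normal_Form.Schur_Decomposition"
begin

definition square_summable :: "('a \<Rightarrow> complex) \<Rightarrow> bool" where
  "square_summable f \<longleftrightarrow> (\<lambda>x. (cmod (f x))\<^sup>2) summable_on UNIV"

lemma square_summable_zero: "square_summable (\<lambda>_. 0)"
  by (simp add: square_summable_def)

lemma square_summable_cmult:
  assumes "square_summable f" shows "square_summable (\<lambda>x. c * f x)"
  using summable_on_cmult_right[OF assms[unfolded square_summable_def], of "(cmod c)\<^sup>2"]
  by (simp add: square_summable_def norm_mult power_mult_distrib)

lemma square_summable_product:
  assumes "square_summable f" "square_summable g"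
  shows "(\<lambda>x. f x * cnj (g x)) summable_on UNIV"
  by (rule abs_summable_summable, rule abs_summable_product)
     (use assms in \<open>simp_all add: square_summable_def norm_mult power2_eq_square\<close>)

lemma square_summable_add:
  assumes "square_summable f" "square_summable g"
  shows "square_summable (\<lambda>x. f x + g x)"
proof -
  have "(\<lambda>x. 2 * (cmod (f x))\<^sup>2 + 2 * (cmod (g x))\<^sup>2) summable_on UNIV"
    using assms unfolding square_summable_def
    by (intro summable_on_add summable_on_cmult_right)
  moreover have "(cmod (f x + g x))\<^sup>2 \<le> 2 * (cmod (f x))\<^sup>2 + 2 * (cmod (g x))\<^sup>2" for x
  proof -
    have "(cmod (f x + g x))\<^sup>2 \<le> (cmod (f x) + cmod (g x))\<^sup>2"
      by (simp add: norm_triangle_ineq power_mono)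
    moreover have "0 \<le> (cmod (f x) - cmod (g x))\<^sup>2" by simp
    ultimately show ?thesis by (simp add: power2_sum power2_diff)
  qed
  ultimately show ?thesis
    unfolding square_summable_def
    by (rule summable_on_comparison_test[where f = "\<lambda>x. 2 * (cmod (f x))\<^sup>2 + 2 * (cmod (g x))\<^sup>2"]) auto
qed

typedef 'a ell2 = "{f :: 'a \<Rightarrow> complex. square_summable f}"
  using square_summable_zero by blast

setup_lifting type_definition_ell2

text \<open>The inner product is linear in its first argument.\<close>

lift_definition cinner :: "'a ell2 \<Rightarrow> 'a ell2 \<Rightarrow> complex" is
  "\<lambda>f g. \<Sum>\<^sub>\<infinity>x. f x * cnj (g x)" .

lift_definition scaleC :: "complex \<Rightarrow> 'a ell2 \<Rightarrow> 'a ell2" is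
  "\<lambda>c f x. c * f x"
  by (rule square_summable_cmult)

lift_definition delta :: "'a \<Rightarrow> 'a ell2" is
  "\<lambda>x y. if y = x then 1 else 0"
proof -
  fix x :: 'a
  have "(\<lambda>y. (cmod (if y = x then 1 else 0))\<^sup>2) summable_on {x}" by simp
  then show "square_summable (\<lambda>y. if y = x then 1 else 0)"
    unfolding square_summable_def
    by (rule summable_on_cong_neutral[THEN iffD1, rotated -1]) auto
qed

instantiation ell2 :: (type) real_inner
begin

lift_definition zero_ell2 :: "'a ell2" is "\<lambda>_. 0"
  by (rule square_summable_zero)

lift_definition plus_ell2 :: "'a ell2 \<Rightarrow> 'a ell2 \<Rightarrow> 'a ell2" is "\<lambda>f g x. f x + g x"
  by (rule square_summable_add)

lift_definition uminus_ell2 :: "'a ell2 \<Rightarrow> 'a ell2" is "\<lambda>f x. - f x"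
  by (simp add: square_summable_def)

definition minus_ell2 :: "'a ell2 \<Rightarrow> 'a ell2 \<Rightarrow> 'a ell2" where
  "minus_ell2 f g = f + (- g)"

definition scaleR_ell2 :: "real \<Rightarrow> 'a ell2 \<Rightarrow> 'a ell2" where
  "scaleR_ell2 r f = scaleC (complex_of_real r) f"

definition inner_ell2 :: "'a ell2 \<Rightarrow> 'a ell2 \<Rightarrow> real" where
  "inner_ell2 f g = Re (cinner f g)"

definition norm_ell2 :: "'a ell2 \<Rightarrow> real" where
  "norm_ell2 f = sqrt (Re (cinner f f))"

definition dist_ell2 :: "'a ell2 \<Rightarrow> 'a ell2 \<Rightarrow> real" where
  "dist_ell2 f g = norm (f - g)"

definition sgn_ell2 :: "'a ell2 \<Rightarrow> 'a ell2" where
  "sgn_ell2 f = scaleC (complex_of_real (inverse (norm f))) f"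

definition uniformity_ell2 :: "('a ell2 \<times> 'a ell2) filter" where
  "uniformity_ell2 = (INF e\<in>{0 <..}. principal {(x, y). dist x y < e})"

definition open_ell2 :: "'a ell2 set \<Rightarrow> bool" where
  "open_ell2 U \<longleftrightarrow> (\<forall>x\<in>U. eventually (\<lambda>(x', y). x' = x \<longrightarrow> y \<in> U) uniformity)"

lemma cinner_add_left_ell2: "cinner (f + g) h = cinner f h + cinner g (h :: 'a ell2)"
proof transfer
  fix f g h :: "'a \<Rightarrow> complex"
  assume "square_summable f" "square_summable g" "square_summable h"
  then have "(\<lambda>x. f x * cnj (h x)) summable_on UNIV" "(\<lambda>x. g x * cnj (h x)) summable_on UNIV"
    by (auto intro: square_summable_product)
  then show "(\<Sum>\<^sub>\<infinity>x. (f x + g x) * cnj (h x))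
      = (\<Sum>\<^sub>\<infinity>x. f x * cnj (h x)) + (\<Sum>\<^sub>\<infinity>x. g x * cnj (h x))"
    by (simp add: ring_distribs infsum_add)
qed

lemma cinner_scaleC_left_ell2: "cinner (scaleC c f) h = c * cinner f (h :: 'a ell2)"
  by transfer (simp add: mult.assoc infsum_cmult_right')

lemma cinner_commute_ell2: "cinner f g = cnj (cinner g (f :: 'a ell2))"
  by transfer (simp only: infsum_cnj[symmetric] complex_cnj_mult complex_cnj_cnj mult.commute)

lemma summable_ell2: "(\<lambda>x. (cmod (Rep_ell2 f x))\<^sup>2) summable_on UNIV"
  using Rep_ell2[of f] by (simp add: square_summable_def)

lemma cinner_self_ell2:
  "cinner f f = complex_of_real (\<Sum>\<^sub>\<infinity>x. (cmod (Rep_ell2 f x))\<^sup>2)" for f :: "'a ell2"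
proof -
  have "cinner f f = (\<Sum>\<^sub>\<infinity>x. complex_of_real ((cmod (Rep_ell2 f x))\<^sup>2))"
    unfolding cinner.rep_eq by (simp only: complex_norm_square)
  also have "\<dots> = complex_of_real (\<Sum>\<^sub>\<infinity>x. (cmod (Rep_ell2 f x))\<^sup>2)"
    by (rule infsumI[OF has_sum_of_real[OF has_sum_infsum[OF summable_ell2]]])
  finally show ?thesis .
qed

instance
proof
  fix f g h :: "'a ell2" and r s :: real
  show "f + g + h = f + (g + h)" by transfer (simp add: fun_eq_iff)
  show "f + g = g + f" by transfer (simp add: fun_eq_iff)
  show "0 + f = f" by transfer simp
  show "- f + f = 0" by transfer simp
  show "f - g = f + - g" by (rule minus_ell2_def)
  show "r *\<^sub>R (f + g) = r *\<^sub>R f + r *\<^sub>R g"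
    unfolding scaleR_ell2_def by transfer (simp add: ring_distribs)
  show "(r + s) *\<^sub>R f = r *\<^sub>R f + s *\<^sub>R f"
    unfolding scaleR_ell2_def by transfer (simp add: ring_distribs)
  show "r *\<^sub>R s *\<^sub>R f = (r * s) *\<^sub>R f"
    unfolding scaleR_ell2_def by transfer (simp add: mult.assoc)
  show "1 *\<^sub>R f = f" unfolding scaleR_ell2_def by transfer simp
  show "inner f g = inner g f"
    unfolding inner_ell2_def by (subst cinner_commute_ell2) simp
  show "inner (f + g) h = inner f h + inner g h"
    by (simp add: inner_ell2_def cinner_add_left_ell2)
  show "inner (r *\<^sub>R f) g = r * inner f g"
    by (simp add: inner_ell2_def scaleR_ell2_def cinner_scaleC_left_ell2)
  show "0 \<le> inner f f"
    by (simp add: inner_ell2_def cinner_self_ell2 infsum_nonneg)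
  show "inner f f = 0 \<longleftrightarrow> f = 0"
  proof
    assume "inner f f = 0"
    then have "(\<Sum>\<^sub>\<infinity>x. (cmod (Rep_ell2 f x))\<^sup>2) = 0"
      by (simp add: inner_ell2_def cinner_self_ell2)
    then have "(cmod (Rep_ell2 f x))\<^sup>2 = 0" for x
      by (intro nonneg_infsum_le_0D[where A = UNIV]) (auto simp: summable_ell2)
    then have "Rep_ell2 f = Rep_ell2 0" by (simp add: zero_ell2.rep_eq fun_eq_iff)
    then show "f = 0" by (simp add: Rep_ell2_inject)
  qed (simp add: inner_ell2_def cinner_self_ell2 zero_ell2.rep_eq)
  show "norm f = sqrt (inner f f)" by (simp add: norm_ell2_def inner_ell2_def)
  show "dist f g = norm (f - g)" by (rule dist_ell2_def)
  show "sgn f = inverse (norm f) *\<^sub>R f" by (simp only: sgn_ell2_def scaleR_ell2_def)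
  show "uniformity = (INF e\<in>{0 <..}. principal {(x :: 'a ell2, y). dist x y < e})"
    by (rule uniformity_ell2_def)
  show "open U \<longleftrightarrow> (\<forall>x\<in>U. \<forall>\<^sub>F (x', y) in uniformity. x' = x \<longrightarrow> y \<in> U)"
    for U :: "'a ell2 set" by (rule open_ell2_def)
qed

end

lemma norm_ell2_sq: "(norm f)\<^sup>2 = (\<Sum>\<^sub>\<infinity>x. (cmod (Rep_ell2 f x))\<^sup>2)"
  by (simp add: norm_ell2_def cinner_self_ell2 infsum_nonneg)

lemma Rep_diff_ell2: "Rep_ell2 (f - g) x = Rep_ell2 f x - Rep_ell2 g x"
  by (simp only: minus_ell2_def plus_ell2.rep_eq uminus_ell2.rep_eq diff_conv_add_uminus)

lemma sum_le_norm_ell2: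
  "finite F \<Longrightarrow> (\<Sum>x\<in>F. (cmod (Rep_ell2 f x))\<^sup>2) \<le> (norm f)\<^sup>2"
  unfolding norm_ell2_sq by (rule finite_sum_le_infsum) (auto simp: summable_ell2)

lemma coord_le_norm_ell2: "cmod (Rep_ell2 f x) \<le> norm f"
  using sum_le_norm_ell2[of "{x}" f] by (simp add: abs_le_square_iff[symmetric])

lemma norm_scaleC: "norm (scaleC c f) = cmod c * norm f"
proof -
  have "cinner (scaleC c f) (scaleC c f) = complex_of_real ((cmod c)\<^sup>2) * cinner f f"
    unfolding cinner_scaleC_left_ell2
    by (subst cinner_commute_ell2) (simp add: cinner_scaleC_left_ell2 cinner_commute_ell2[of f f, symmetric]
        complex_norm_square del: of_real_power)
  then show ?thesis
    by (simp add: norm_ell2_def real_sqrt_mult del: of_real_power)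
qed

instance ell2 :: (type) complete_space
proof
  fix X :: "nat \<Rightarrow> 'a ell2"
  assume C: "Cauchy X"
  have "Cauchy (\<lambda>n. Rep_ell2 (X n) x)" for x
  proof (rule metric_CauchyI)
    fix e :: real assume "0 < e"
    then obtain M where "\<forall>m\<ge>M. \<forall>n\<ge>M. dist (X m) (X n) < e"
      using C by (meson metric_CauchyD)
    then show "\<exists>M. \<forall>m\<ge>M. \<forall>n\<ge>M. dist (Rep_ell2 (X m) x) (Rep_ell2 (X n) x) < e"
      by (metis Rep_diff_ell2 coord_le_norm_ell2 dist_norm le_less_trans)
  qed
  then have "\<forall>x. \<exists>l. (\<lambda>n. Rep_ell2 (X n) x) \<longlonglongrightarrow> l"
    by (simp add: Cauchy_convergent_iff convergent_def)
  then obtain g where g: "\<And>x. (\<lambda>n. Rep_ell2 (X n) x) \<longlonglongrightarrow> g x" by metis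
  have fin: "(\<Sum>x\<in>F. (cmod (Rep_ell2 (X n) x - g x))\<^sup>2) \<le> e\<^sup>2"
    if "finite F" "n \<ge> M" and M: "\<forall>m\<ge>M. \<forall>n\<ge>M. dist (X m) (X n) < e" for F n M e
  proof (rule LIMSEQ_le_const2)
    show "(\<lambda>m. \<Sum>x\<in>F. (cmod (Rep_ell2 (X n) x - Rep_ell2 (X m) x))\<^sup>2)
        \<longlonglongrightarrow> (\<Sum>x\<in>F. (cmod (Rep_ell2 (X n) x - g x))\<^sup>2)"
      by (intro tendsto_intros g)
    show "\<exists>N. \<forall>m\<ge>N. (\<Sum>x\<in>F. (cmod (Rep_ell2 (X n) x - Rep_ell2 (X m) x))\<^sup>2) \<le> e\<^sup>2"
    proof (intro exI allI impI)
      fix m assume "m \<ge> M"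
      then have "norm (X n - X m) < e" using M \<open>n \<ge> M\<close> by (simp add: dist_norm)
      then have "(norm (X n - X m))\<^sup>2 \<le> e\<^sup>2" by (intro power_mono) auto
      then show "(\<Sum>x\<in>F. (cmod (Rep_ell2 (X n) x - Rep_ell2 (X m) x))\<^sup>2) \<le> e\<^sup>2"
        using sum_le_norm_ell2[OF \<open>finite F\<close>, of "X n - X m"] by (simp add: Rep_diff_ell2)
    qed
  qed
  have diff: "square_summable (\<lambda>x. Rep_ell2 (X n) x - g x)"
    if "n \<ge> M" "\<forall>m\<ge>M. \<forall>n\<ge>M. dist (X m) (X n) < e" for n M e
    unfolding square_summable_def
    by (rule nonneg_bdd_above_summable_on) (use fin[OF _ that] in \<open>auto intro!: bdd_aboveI\<close>)
  obtain M where M: "\<forall>m\<ge>M. \<forall>n\<ge>M. dist (X m) (X n) < 1"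
    using metric_CauchyD[OF C, of 1] by auto
  have "square_summable (\<lambda>x. Rep_ell2 (X M) x + (-1) * (Rep_ell2 (X M) x - g x))"
    by (intro square_summable_add square_summable_cmult diff[OF _ M]) (use Rep_ell2[of "X M"] in auto)
  then have "square_summable g" by simp
  then have Rep: "Rep_ell2 (Abs_ell2 g) = g" by (simp add: Abs_ell2_inverse)
  have "X \<longlonglongrightarrow> Abs_ell2 g"
  proof (rule metric_LIMSEQ_I)
    fix e :: real assume e: "0 < e"
    then obtain M where M: "\<forall>m\<ge>M. \<forall>n\<ge>M. dist (X m) (X n) < e / 2"
      using C by (meson metric_CauchyD half_gt_zero)
    have "dist (X n) (Abs_ell2 g) < e" if "n \<ge> M" for n
    proof -
      have "(norm (X n - Abs_ell2 g))\<^sup>2 \<le> (e / 2)\<^sup>2"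
        unfolding norm_ell2_sq Rep_diff_ell2 Rep
      proof (rule infsum_le_finite_sums)
        show "(\<lambda>x. (cmod (Rep_ell2 (X n) x - g x))\<^sup>2) summable_on UNIV"
          using diff[OF that M] by (simp add: square_summable_def)
        show "(\<Sum>x\<in>F. (cmod (Rep_ell2 (X n) x - g x))\<^sup>2) \<le> (e / 2)\<^sup>2" if "finite F" for F
          using fin[OF that \<open>n \<ge> M\<close> M] .
      qed
      then have "norm (X n - Abs_ell2 g) \<le> e / 2"
        by (rule power2_le_imp_le) (use e in simp)
      then show ?thesis using e by (simp add: dist_norm)
    qed
    then show "\<exists>M. \<forall>n\<ge>M. dist (X n) (Abs_ell2 g) < e" by blast
  qed
  then show "convergent X" by (auto simp: convergent_def)
qed

lemma cinner_add_right: "cinner f (g + h) = cinner f g + cinner f (h :: 'a ell2)"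
  by (subst (1 2 3) cinner_commute_ell2) (simp add: cinner_add_left_ell2)

lemma cinner_scaleC_right: "cinner f (scaleC c g) = cnj c * cinner f (g :: 'a ell2)"
  by (subst (1 2) cinner_commute_ell2) (simp add: cinner_scaleC_left_ell2)

lemma scaleC_add_right: "scaleC c (f + g) = scaleC c f + scaleC c g"
  by transfer (simp add: ring_distribs)

lemma scaleC_scaleR: "scaleC c (r *\<^sub>R f) = r *\<^sub>R scaleC c f"
  unfolding scaleR_ell2_def by transfer (simp add: mult.left_commute)

lemma bounded_linear_scaleC: "bounded_linear (scaleC c)"
  by (rule bounded_linear_intro[where K = "cmod c"])
     (simp_all add: scaleC_add_right scaleC_scaleR norm_scaleC mult.commute)

lemma cmod_cinner_le: "cmod (cinner f g) \<le> norm f * norm g"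
proof -
  define c where "c = cnj (sgn (cinner f g))"
  have "cmod (cinner f g) = Re (c * cinner f g)"
  proof (cases "cinner f g = 0")
    case False
    have "c * cinner f g = (cinner f g * cnj (cinner f g)) / complex_of_real (cmod (cinner f g))"
      by (simp add: c_def sgn_eq)
    also have "\<dots> = complex_of_real ((cmod (cinner f g))\<^sup>2 / cmod (cinner f g))"
      by (simp only: complex_norm_square[symmetric] of_real_divide)
    finally show ?thesis using False by (simp add: power2_eq_square)
  qed (simp add: c_def)
  also have "\<dots> = inner (scaleC c f) g"
    by (simp add: inner_ell2_def cinner_scaleC_left_ell2)
  also have "\<dots> \<le> norm (scaleC c f) * norm g"
    by (rule norm_cauchy_schwarz)
  also have "\<dots> \<le> norm f * norm g"
    by (intro mult_right_mono) (auto simp: norm_scaleC c_def norm_sgn)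
  finally show ?thesis .
qed

lemma bounded_linear_cinner_left: "bounded_linear (\<lambda>f. cinner f g)"
  by (rule bounded_linear_intro[where K = "norm g"])
     (simp_all add: cinner_add_left_ell2 scaleR_ell2_def cinner_scaleC_left_ell2 cmod_cinner_le
       scaleR_conv_of_real)

lemma Rep_sum_delta:
  "finite F \<Longrightarrow> Rep_ell2 (\<Sum>y\<in>F. scaleC (a y) (delta y)) x = (if x \<in> F then a x else 0)"
  by (induction F rule: finite_induct)
     (auto simp: zero_ell2.rep_eq plus_ell2.rep_eq scaleC.rep_eq delta.rep_eq)

lemma cinner_delta_right: "cinner f (delta x) = Rep_ell2 f x"
proof -
  have "cinner f (delta x) = (\<Sum>\<^sub>\<infinity>y\<in>{x}. Rep_ell2 f y)"
    unfolding cinner.rep_eq delta.rep_eq by (rule infsum_cong_neutral) auto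
  then show ?thesis by simp
qed

lemma ell2_has_sum_delta: "((\<lambda>x. scaleC (Rep_ell2 f x) (delta x)) has_sum f) UNIV"
  unfolding has_sum_def
proof (rule Lim_null[THEN iffD2], rule tendsto_norm_zero_cancel)
  let ?S = "\<lambda>F. \<Sum>x\<in>F. scaleC (Rep_ell2 f x) (delta x)"
  let ?q = "\<lambda>x. (cmod (Rep_ell2 f x))\<^sup>2"
  have "(sum ?q \<longlongrightarrow> infsum ?q UNIV) (finite_subsets_at_top UNIV)"
    using has_sum_infsum[OF summable_ell2[of f]] by (simp add: has_sum_def)
  then have "((\<lambda>F. infsum ?q UNIV - sum ?q F) \<longlongrightarrow> infsum ?q UNIV - infsum ?q UNIV)
      (finite_subsets_at_top UNIV)"
    by (intro tendsto_intros)
  moreover have "\<forall>\<^sub>F F in finite_subsets_at_top UNIV.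
      infsum ?q UNIV - sum ?q F = (norm (?S F - f))\<^sup>2"
  proof (rule eventually_finite_subsets_at_top_weakI)
    fix F :: "'a set" assume F: "finite F"
    have "(norm (?S F - f))\<^sup>2 = (\<Sum>\<^sub>\<infinity>x\<in>UNIV - F. ?q x)"
      unfolding norm_ell2_sq Rep_diff_ell2
      by (rule infsum_cong_neutral) (use F in \<open>auto simp: Rep_sum_delta\<close>)
    also have "\<dots> = infsum ?q UNIV - sum ?q F"
      using F by (subst infsum_Diff) (auto simp: summable_ell2)
    finally show "infsum ?q UNIV - sum ?q F = (norm (?S F - f))\<^sup>2" by simp
  qed
  ultimately have "((\<lambda>F. (norm (?S F - f))\<^sup>2) \<longlongrightarrow> 0) (finite_subsets_at_top UNIV)"
    by (simp add: filterlim_cong)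
  then have "((\<lambda>F. sqrt ((norm (?S F - f))\<^sup>2)) \<longlongrightarrow> sqrt 0) (finite_subsets_at_top UNIV)"
    by (rule tendsto_real_sqrt)
  then show "((\<lambda>F. norm (?S F - f)) \<longlongrightarrow> 0) (finite_subsets_at_top UNIV)"
    by simp
qed

lemma ell2_eqI_cinner:
  assumes "\<And>h. cinner h f = cinner h g" shows "f = g"
proof -
  have "Rep_ell2 f x = Rep_ell2 g x" for x
    using assms[of "delta x"]
    by (subst (asm) (1 2) cinner_commute_ell2) (simp add: cinner_delta_right)
  then show ?thesis by (metis Rep_ell2_inject ext)
qed

text \<open>
  The type \<open>'a ell2 \<Rightarrow>\<^sub>L 'a ell2\<close> consists of the bounded real-linear operators; the set of those that
  are complex-linear is norm closed in it, and the two operator norms agree.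
\<close>

definition bounded_ops :: "('a ell2 \<Rightarrow>\<^sub>L 'a ell2) set" where
  "bounded_ops = {u. \<forall>c \<xi>. blinfun_apply u (scaleC c \<xi>) = scaleC c (blinfun_apply u \<xi>)}"

definition scaleC_op :: "complex \<Rightarrow> ('a ell2 \<Rightarrow>\<^sub>L 'a ell2) \<Rightarrow> ('a ell2 \<Rightarrow>\<^sub>L 'a ell2)" where
  "scaleC_op c u = Blinfun (\<lambda>\<xi>. scaleC c (blinfun_apply u \<xi>))"

lemma scaleC_op_apply: "blinfun_apply (scaleC_op c u) \<xi> = scaleC c (blinfun_apply u \<xi>)"
  unfolding scaleC_op_def
  by (subst bounded_linear_Blinfun_apply)
     (auto intro: bounded_linear_compose[OF bounded_linear_scaleC blinfun.bounded_linear_right])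

definition adj :: "('a ell2 \<Rightarrow>\<^sub>L 'a ell2) \<Rightarrow> ('a ell2 \<Rightarrow>\<^sub>L 'a ell2)" where
  "adj u = (THE v. v \<in> bounded_ops \<and>
     (\<forall>\<xi> \<eta>. cinner (blinfun_apply u \<xi>) \<eta> = cinner \<xi> (blinfun_apply v \<eta>)))"

lemma adj_exists:
  assumes u: "u \<in> bounded_ops"
  shows "\<exists>v\<in>bounded_ops. \<forall>\<xi> \<eta>. cinner (blinfun_apply u \<xi>) \<eta> = cinner \<xi> (blinfun_apply v \<eta>)"
proof -
  define h where "h \<eta> x = cnj (cinner (blinfun_apply u (delta x)) \<eta>)" for \<eta> x
  have bd: "(\<Sum>x\<in>F. (cmod (h \<eta> x))\<^sup>2) \<le> (norm u * norm \<eta>)\<^sup>2" if F: "finite F" for F \<eta>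
  proof -
    define \<xi> where "\<xi> = (\<Sum>x\<in>F. scaleC (h \<eta> x) (delta x))"
    let ?S = "\<Sum>x\<in>F. (cmod (h \<eta> x))\<^sup>2"
    have "(norm \<xi>)\<^sup>2 = (\<Sum>\<^sub>\<infinity>x\<in>F. (cmod (h \<eta> x))\<^sup>2)"
      unfolding norm_ell2_sq \<xi>_def
      by (rule infsum_cong_neutral) (use F in \<open>auto simp: Rep_sum_delta\<close>)
    then have n: "(norm \<xi>)\<^sup>2 = ?S" using F by simp
    have "blinfun_apply u \<xi> = (\<Sum>x\<in>F. scaleC (h \<eta> x) (blinfun_apply u (delta x)))"
      using u unfolding \<xi>_def by (simp add: blinfun.sum_right bounded_ops_def)
    then have "cinner (blinfun_apply u \<xi>) \<eta> = (\<Sum>x\<in>F. h \<eta> x * cnj (h \<eta> x))"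
      by (simp add: linear_sum[OF bounded_linear.linear[OF bounded_linear_cinner_left]]
          cinner_scaleC_left_ell2) (simp add: h_def)
    also have "\<dots> = complex_of_real ?S"
      by (simp add: complex_norm_square del: of_real_power)
    finally have "?S = Re (cinner (blinfun_apply u \<xi>) \<eta>)" by simp
    also have "\<dots> \<le> norm (blinfun_apply u \<xi>) * norm \<eta>"
      using cmod_cinner_le[of "blinfun_apply u \<xi>" \<eta>] complex_Re_le_cmod order_trans by blast
    also have "\<dots> \<le> (norm u * norm \<xi>) * norm \<eta>"
      by (intro mult_right_mono norm_blinfun) auto
    finally have le: "(norm \<xi>)\<^sup>2 \<le> norm \<xi> * (norm u * norm \<eta>)"
      unfolding n by (simp add: algebra_simps)
    have "norm \<xi> \<le> norm u * norm \<eta>"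
    proof (cases "norm \<xi> = 0")
      case False
      then show ?thesis using le by (simp add: power2_eq_square)
    qed simp
    then show ?thesis unfolding n[symmetric] by (intro power_mono) auto
  qed
  have sq: "square_summable (h \<eta>)" for \<eta>
    unfolding square_summable_def
    by (rule nonneg_bdd_above_summable_on) (use bd in \<open>auto intro!: bdd_aboveI\<close>)
  define v where "v \<eta> = Abs_ell2 (h \<eta>)" for \<eta>
  have Rep_v: "Rep_ell2 (v \<eta>) = h \<eta>" for \<eta>
    by (simp add: v_def Abs_ell2_inverse sq)
  have v: "cinner (blinfun_apply u \<xi>) \<eta> = cinner \<xi> (v \<eta>)" for \<xi> \<eta>
  proof -
    have "bounded_linear (\<lambda>\<xi>. cinner (blinfun_apply u \<xi>) \<eta>)"
      by (rule bounded_linear_compose[OF bounded_linear_cinner_left blinfun.bounded_linear_right])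
    from has_sum_bounded_linear[OF this ell2_has_sum_delta[of \<xi>]]
    have "((\<lambda>x. Rep_ell2 \<xi> x * cnj (h \<eta> x)) has_sum cinner (blinfun_apply u \<xi>) \<eta>) UNIV"
      using u by (simp add: o_def bounded_ops_def cinner_scaleC_left_ell2 h_def)
    then show ?thesis by (simp add: cinner.rep_eq Rep_v infsumI)
  qed
  have "bounded_linear v"
  proof (rule bounded_linear_intro[where K = "norm u"])
    show "v (\<eta> + \<zeta>) = v \<eta> + v \<zeta>" for \<eta> \<zeta>
      by (rule ell2_eqI_cinner) (simp add: v[symmetric] cinner_add_right)
    show "v (r *\<^sub>R \<eta>) = r *\<^sub>R v \<eta>" for r \<eta>
      by (rule ell2_eqI_cinner) (simp add: v[symmetric] scaleR_ell2_def cinner_scaleC_right)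
    show "norm (v \<eta>) \<le> norm \<eta> * norm u" for \<eta>
    proof (rule power2_le_imp_le)
      show "(norm (v \<eta>))\<^sup>2 \<le> (norm \<eta> * norm u)\<^sup>2"
        unfolding norm_ell2_sq Rep_v
        unfolding mult.commute[of "norm \<eta>"]
      proof (rule infsum_le_finite_sums)
        show "(\<lambda>x. (cmod (h \<eta> x))\<^sup>2) summable_on UNIV"
          using sq[of \<eta>] by (simp add: square_summable_def)
        show "(\<Sum>x\<in>F. (cmod (h \<eta> x))\<^sup>2) \<le> (norm u * norm \<eta>)\<^sup>2" if "finite F" for F
          using bd[OF that] .
      qed
    qed simp
  qed
  then have app: "blinfun_apply (Blinfun v) = v" by (rule bounded_linear_Blinfun_apply)
  have "v (scaleC c \<eta>) = scaleC c (v \<eta>)" for c \<eta>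
    by (rule ell2_eqI_cinner) (simp add: v[symmetric] cinner_scaleC_right)
  then have "Blinfun v \<in> bounded_ops" by (simp add: bounded_ops_def app)
  then show ?thesis by (rule bexI[rotated]) (simp add: app v)
qed

lemma adj:
  assumes "u \<in> bounded_ops"
  shows "adj u \<in> bounded_ops"
    and "cinner (blinfun_apply u \<xi>) \<eta> = cinner \<xi> (blinfun_apply (adj u) \<eta>)"
proof -
  have "\<exists>!v. v \<in> bounded_ops \<and>
      (\<forall>\<xi> \<eta>. cinner (blinfun_apply u \<xi>) \<eta> = cinner \<xi> (blinfun_apply v \<eta>))"
  proof (rule ex_ex1I)
    show "\<exists>v. v \<in> bounded_ops \<and>
        (\<forall>\<xi> \<eta>. cinner (blinfun_apply u \<xi>) \<eta> = cinner \<xi> (blinfun_apply v \<eta>))"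
      using adj_exists[OF assms] by blast
    fix v w :: "'a ell2 \<Rightarrow>\<^sub>L 'a ell2"
    assume "v \<in> bounded_ops \<and> (\<forall>\<xi> \<eta>. cinner (blinfun_apply u \<xi>) \<eta> = cinner \<xi> (blinfun_apply v \<eta>))"
      and "w \<in> bounded_ops \<and> (\<forall>\<xi> \<eta>. cinner (blinfun_apply u \<xi>) \<eta> = cinner \<xi> (blinfun_apply w \<eta>))"
    then show "v = w"
      by (metis blinfun_eqI ell2_eqI_cinner)
  qed
  from theI'[OF this] show "adj u \<in> bounded_ops"
    and "cinner (blinfun_apply u \<xi>) \<eta> = cinner \<xi> (blinfun_apply (adj u) \<eta>)"
    unfolding adj_def by blast+
qed

record 'a star_algebra = "'a partial_object" +
  alg_add :: "'a \<Rightarrow> 'a \<Rightarrow> 'a"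
  alg_scale :: "complex \<Rightarrow> 'a \<Rightarrow> 'a"
  alg_mult :: "'a \<Rightarrow> 'a \<Rightarrow> 'a"
  alg_star :: "'a \<Rightarrow> 'a"

text \<open>Homomorphisms are not required to preserve units.\<close>

definition star_hom :: "'a star_algebra \<Rightarrow> 'b star_algebra \<Rightarrow> ('a \<Rightarrow> 'b) \<Rightarrow> bool" where
  "star_hom A B \<phi> \<longleftrightarrow>
     \<phi> \<in> carrier A \<rightarrow> carrier B \<and>
     (\<forall>a\<in>carrier A. \<forall>b\<in>carrier A. \<phi> (alg_add A a b) = alg_add B (\<phi> a) (\<phi> b)) \<and>
     (\<forall>c. \<forall>a\<in>carrier A. \<phi> (alg_scale A c a) = alg_scale B c (\<phi> a)) \<and>
     (\<forall>a\<in>carrier A. \<forall>b\<in>carrier A. \<phi> (alg_mult A a b) = alg_mult B (\<phi> a) (\<phi> b)) \<and>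
     (\<forall>a\<in>carrier A. \<phi> (alg_star A a) = alg_star B (\<phi> a))"

definition star_embedding :: "'a star_algebra \<Rightarrow> 'b star_algebra \<Rightarrow> ('a \<Rightarrow> 'b) \<Rightarrow> bool" where
  "star_embedding A B \<phi> \<longleftrightarrow> star_hom A B \<phi> \<and> inj_on \<phi> (carrier A)"

definition uniformly_locally_finite :: "'a::metric_space itself \<Rightarrow> bool" where
  "uniformly_locally_finite _ \<longleftrightarrow>
     (\<forall>R>0. \<exists>N. \<forall>x::'a. finite (cball x R) \<and> card (cball x R) \<le> N)"

definition propagation_le :: "real \<Rightarrow> ('a::metric_space ell2 \<Rightarrow>\<^sub>L 'a ell2) set" where
  "propagation_le R = {u \<in> bounded_ops.
     \<forall>x y. dist x y > R \<longrightarrow> cinner (blinfun_apply u (delta x)) (delta y) = 0}"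

definition uniform_Roe_algebra :: "('a::metric_space ell2 \<Rightarrow>\<^sub>L 'a ell2) star_algebra" where
  "uniform_Roe_algebra =
     \<lparr> carrier = closure (\<Union>R\<in>{0<..}. propagation_le R),
       alg_add = (+),
       alg_scale = scaleC_op,
       alg_mult = (o\<^sub>L),
       alg_star = adj \<rparr>"

lemma closed_bounded_ops: "closed (bounded_ops :: ('a ell2 \<Rightarrow>\<^sub>L 'a ell2) set)"
proof -
  have "bounded_ops = (\<Inter>c. \<Inter>\<xi>. {u :: 'a ell2 \<Rightarrow>\<^sub>L 'a ell2.
      blinfun_apply u (scaleC c \<xi>) = scaleC c (blinfun_apply u \<xi>)})"
    by (auto simp: bounded_ops_def)
  also have "closed \<dots>"
    by (intro closed_INT ballI closed_Collect_eq
        bounded_linear.continuous_on[OF bounded_linear_scaleC] continuous_intros)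
  finally show ?thesis .
qed

lemma uniform_Roe_algebra_subset: "carrier uniform_Roe_algebra \<subseteq> bounded_ops"
  unfolding uniform_Roe_algebra_def partial_object.simps
  by (rule closure_minimal) (auto simp: propagation_le_def closed_bounded_ops)

definition vec_norm2 :: "complex vec \<Rightarrow> real" where
  "vec_norm2 v = sqrt (Re (v \<bullet>c v))"

text \<open>The operator norm with respect to the Euclidean norms, i.e. the C*-norm on square matrices.\<close>

definition mat_opnorm :: "complex mat \<Rightarrow> real" where
  "mat_opnorm A = (SUP v\<in>{v \<in> carrier_vec (dim_col A). vec_norm2 v \<le> 1}. vec_norm2 (A *\<^sub>v v))"

text \<open>
  The entry with index \<open>n\<close> is a matrix of size \<open>Suc n\<close>, so the factors are the matrix algebras of
  sizes \<open>1, 2, 3, \<dots>\<close>.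
\<close>

definition matrix_product :: "(nat \<Rightarrow> complex mat) star_algebra" where
  "matrix_product =
     \<lparr> carrier = {a. (\<forall>n. a n \<in> carrier_mat (Suc n) (Suc n)) \<and>
                     bdd_above (range (\<lambda>n. mat_opnorm (a n)))},
       alg_add = (\<lambda>a b n. a n + b n),
       alg_scale = (\<lambda>c a n. c \<cdot>\<^sub>m a n),
       alg_mult = (\<lambda>a b n. a n * b n),
       alg_star = (\<lambda>a n. mat_adjoint (a n)) \<rparr>"

end

theory Submission
  imports Defs "HOL-Library.Nat_Bijection" "HOL-Library.Real_Mod" "HOL-Number_Theory.Cong"
begin

text \<open>
  The idea is that an operator of propagation at most \<open>r\<close> has at most \<open>N\<close> nonzero entries per row
  and column, while the image of a typical unitary matrix of size \<open>d\<close> spreads its mass thinly over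
  all entries, so that for large \<open>d\<close> the former cannot approximate the latter.

  Let \<open>\<phi>\<close> be an embedding. Since \<open>\<phi>\<close> does not vanish on the block of size \<open>d\<close>, there are unit
  vectors \<open>\<xi>\<^sub>0, \<dots>, \<xi>\<^bsub>d-1\<^esub>\<close> on which that block acts through \<open>\<phi>\<close> as it does on the standard basis
  of \<open>\<complex>\<^sup>d\<close> (\<open>star_embedding_block_vectors\<close>). If \<open>u\<close> is a unitary of the block and \<open>w\<close> is within
  \<open>1/2\<close> of the image of an element with block \<open>u\<close>, then the pairing
  \<open>\<Sum>\<^sub>j \<langle>w \<xi>\<^sub>j, \<phi>(u) \<xi>\<^sub>j\<rangle>\<close> is within \<open>d/2\<close> of \<open>\<Sum>\<^sub>j \<parallel>\<phi>(u) \<xi>\<^sub>j\<parallel>\<^sup>2 = d\<close>. On the other hand, write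
  \<open>A\<^sub>x \<in> \<complex>\<^sup>d\<close> for the vector of the coordinates \<open>\<xi>\<^sub>j(x)\<close>. If \<open>w\<close> has propagation at most \<open>r\<close>,
  the pairing involves only pairs of points at distance at most \<open>r\<close>, and it is at most
  \<open>\<parallel>w\<parallel>\<close> times the sum of certain coefficients \<open>|c\<^sub>u(A\<^sub>x, A\<^sub>y)|\<close> over these pairs
  (\<open>finite_propagation_pairing_le\<close>). Here \<open>c\<^sub>u(\<alpha>, \<beta>)\<close> is a matrix coefficient of \<open>u\<close>, and by
  Schur orthogonality its mean square over the \<open>d\<^sup>2\<close> Weyl matrices, that is, the products of a cyclic shift
  and a diagonal character, is \<open>\<parallel>\<alpha>\<parallel>\<^sup>2 \<parallel>\<beta>\<parallel>\<^sup>2 / d\<close> (\<open>sum_weyl_coeff_sq\<close>). As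
  \<open>\<Sum>\<^sub>x \<parallel>A\<^sub>x\<parallel>\<^sup>2 = d\<close>, averaging yields a Weyl matrix for which the sum is at most \<open>N \<surd>d\<close>
  (\<open>exists_delocalised_weyl\<close>).

  This Weyl matrix depends on \<open>\<phi>\<close>, \<open>d\<close> and \<open>r\<close> only, not on \<open>w\<close>. So one can place such
  matrices in the blocks of a single element \<open>a\<close> of the product in such a way that each radius \<open>r\<close>
  from a cofinal sequence is used in infinitely many blocks. Approximating \<open>\<phi>(a)\<close> by one \<open>w\<close> of finite
  propagation then gives \<open>d/2 \<le> \<parallel>w\<parallel> N \<surd>d\<close> for fixed \<open>w\<close> and \<open>N\<close> and arbitrarily large \<open>d\<close>,
  which is absurd. The link between \<open>a\<close> and its block \<open>u\<close> is the relation \<open>\<phi>(a) \<xi>\<^sub>j = \<phi>(u) \<xi>\<^sub>j\<close>,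
  which is multiplicativity of \<open>\<phi>\<close>: the \<open>\<xi>\<^sub>j\<close> lie in the range of the image of the unit of the block.
\<close>

section \<open>Averaging over Weyl matrices\<close>

definition phase :: "nat \<Rightarrow> nat \<Rightarrow> nat \<Rightarrow> complex" where
  "phase d l j = cis (2 * pi * real l * real j / real d)"

definition weyl :: "nat \<Rightarrow> nat \<Rightarrow> nat \<Rightarrow> complex mat" where
  "weyl d k l = mat d d (\<lambda>(i, j). if i = (j + k) mod d then phase d l j else 0)"

text \<open>
  With \<open>U = weyl d k l\<close> this is the sesquilinear form \<open>\<Sum>\<^sub>j \<alpha>\<^sub>j cnj ((U\<^sup>T \<beta>)\<^sub>j)\<close>. If \<open>\<alpha>\<close> and \<open>\<beta>\<close> are
  the coordinates of vectors \<open>\<xi>\<^sub>j\<close> at two points \<open>x\<close> and \<open>y\<close>, it is the \<open>(x, y)\<close> entry of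
  \<open>\<Sum>\<^sub>j \<xi>\<^sub>j \<otimes> cnj \<zeta>\<^sub>j\<close>, where \<open>\<zeta>\<^sub>j = \<Sum>\<^sub>i U\<^sub>i\<^sub>j \<xi>\<^sub>i\<close>.
\<close>

definition weyl_coeff ::
  "nat \<Rightarrow> nat \<Rightarrow> nat \<Rightarrow> (nat \<Rightarrow> complex) \<Rightarrow> (nat \<Rightarrow> complex) \<Rightarrow> complex" where
  "weyl_coeff d k l \<alpha> \<beta> = (\<Sum>j<d. \<alpha> j * cnj (phase d l j * \<beta> ((j + k) mod d)))"

lemma cmod_phase [simp]: "cmod (phase d l j) = 1"
  by (simp add: phase_def)

lemma sum_phase_orthogonal:
  assumes "i < d" "j < d"
  shows "(\<Sum>l<d. cnj (phase d l i) * phase d l j) = (if i = j then of_nat d else 0)"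
proof -
  define z where "z = cis (2 * pi * (real j - real i) / real d)"
  have eq: "cnj (phase d l i) * phase d l j = z ^ l" for l
    by (simp add: phase_def z_def cis_cnj cis_mult Complex.DeMoivre)
       (simp add: diff_divide_distrib algebra_simps)
  show ?thesis
  proof (cases "i = j")
    case True
    then have "z = 1" by (simp add: z_def)
    then show ?thesis unfolding eq using True by simp
  next
    case False
    have "z \<noteq> 1"
    proof
      assume "z = 1"
      then obtain m :: int where "2 * pi * (real j - real i) / real d = of_int m * (2 * pi)"
        by (auto simp: z_def cis_eq_1_iff)
      then have "2 * pi * (real j - real i) = 2 * pi * (of_int m * real d)"
        using assms by (simp add: field_simps)
      then have "real j - real i = of_int m * real d"
        by (simp only: mult_cancel_left) simp
      then have "real_of_int (int j - int i) = real_of_int (m * int d)" by simp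
      then have "int j - int i = m * int d" by (simp only: of_int_eq_iff)
      then have "int d dvd int j - int i" by simp
      moreover have "\<bar>int j - int i\<bar> < int d" using assms by linarith
      ultimately have "int j - int i = 0" by (metis dvd_imp_le_int linorder_not_le abs_of_nat)
      then show False using False by simp
    qed
    moreover have "z ^ d = 1"
    proof -
      have "z ^ d = cis (2 * pi * real_of_int (int j - int i))"
        using assms by (simp add: z_def Complex.DeMoivre)
      also have "\<dots> = 1" by (rule cis_multiple_2pi) simp
      finally show ?thesis .
    qed
    ultimately show ?thesis unfolding eq using False by (simp add: geometric_sum)
  qed
qed

lemma sum_phase_parseval:
  "(\<Sum>l<d. (cmod (\<Sum>j<d. c j * cnj (phase d l j)))\<^sup>2) = real d * (\<Sum>j<d. (cmod (c j))\<^sup>2)"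
proof -
  have "complex_of_real (\<Sum>l<d. (cmod (\<Sum>j<d. c j * cnj (phase d l j)))\<^sup>2)
      = (\<Sum>l<d. (\<Sum>i<d. c i * cnj (phase d l i)) * (\<Sum>j<d. cnj (c j) * phase d l j))"
    by (simp add: complex_norm_square del: of_real_power)
  also have "\<dots> = (\<Sum>l<d. \<Sum>i<d. \<Sum>j<d. c i * cnj (c j) * (cnj (phase d l i) * phase d l j))"
    by (simp add: sum_product mult_ac)
  also have "\<dots> = (\<Sum>i<d. \<Sum>l<d. \<Sum>j<d. c i * cnj (c j) * (cnj (phase d l i) * phase d l j))"
    by (rule sum.swap)
  also have "\<dots> = (\<Sum>i<d. \<Sum>j<d. \<Sum>l<d. c i * cnj (c j) * (cnj (phase d l i) * phase d l j))"
    by (intro sum.cong refl sum.swap)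
  also have "\<dots> = (\<Sum>i<d. \<Sum>j<d. c i * cnj (c j) * (if i = j then of_nat d else 0))"
    by (simp add: sum_phase_orthogonal flip: sum_distrib_left)
  also have "\<dots> = (\<Sum>i<d. \<Sum>j<d. if i = j then c i * cnj (c i) * of_nat d else 0)"
    by (intro sum.cong) auto
  also have "\<dots> = complex_of_real (real d * (\<Sum>j<d. (cmod (c j))\<^sup>2))"
    by (simp add: sum_distrib_left complex_norm_square mult_ac del: of_real_power)
  finally show ?thesis by (simp only: of_real_eq_iff)
qed

lemma bij_betw_cyclic_shift: "bij_betw (\<lambda>j. (j + k) mod d) {..<d} {..<d :: nat}"
proof -
  have "inj_on (\<lambda>j. (j + k) mod d) {..<d}"
  proof (rule inj_onI)
    fix i j assume "i \<in> {..<d}" "j \<in> {..<d}" "(i + k) mod d = (j + k) mod d"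
    then have "[i + k = j + k] (mod d)" by (simp add: cong_def)
    then have "[i = j] (mod d)" by (simp add: cong_add_rcancel_nat)
    then show "i = j" using \<open>i \<in> _\<close> \<open>j \<in> _\<close> by (simp add: cong_def)
  qed
  moreover have "(\<lambda>j. (j + k) mod d) ` {..<d} \<subseteq> {..<d}" by auto
  ultimately show ?thesis
    by (simp add: bij_betw_def endo_inj_surj)
qed

text \<open>
  Schur orthogonality for the Weyl matrices. Parseval's identity for the characters of the cyclic
  group removes the interference between different \<open>j\<close>; the sum over the shifts then pairs each
  \<open>\<alpha>\<^sub>j\<close> with each \<open>\<beta>\<^sub>i\<close> exactly once.
\<close>

lemma sum_weyl_coeff_sq:
  "(\<Sum>k<d. \<Sum>l<d. (cmod (weyl_coeff d k l \<alpha> \<beta>))\<^sup>2)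
    = real d * ((\<Sum>j<d. (cmod (\<alpha> j))\<^sup>2) * (\<Sum>j<d. (cmod (\<beta> j))\<^sup>2))"
proof -
  have "(\<Sum>l<d. (cmod (weyl_coeff d k l \<alpha> \<beta>))\<^sup>2)
      = real d * (\<Sum>j<d. (cmod (\<alpha> j * cnj (\<beta> ((j + k) mod d))))\<^sup>2)" for k
    using sum_phase_parseval[where c = "\<lambda>j. \<alpha> j * cnj (\<beta> ((j + k) mod d))" and d = d]
    by (simp add: weyl_coeff_def mult_ac)
  then have "(\<Sum>k<d. \<Sum>l<d. (cmod (weyl_coeff d k l \<alpha> \<beta>))\<^sup>2)
      = real d * (\<Sum>k<d. \<Sum>j<d. (cmod (\<alpha> j))\<^sup>2 * (cmod (\<beta> ((j + k) mod d)))\<^sup>2)"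
    by (simp add: sum_distrib_left norm_mult power_mult_distrib)
  also have "(\<Sum>k<d. \<Sum>j<d. (cmod (\<alpha> j))\<^sup>2 * (cmod (\<beta> ((j + k) mod d)))\<^sup>2)
      = (\<Sum>j<d. \<Sum>k<d. (cmod (\<alpha> j))\<^sup>2 * (cmod (\<beta> ((j + k) mod d)))\<^sup>2)"
    by (rule sum.swap)
  also have "\<dots> = (\<Sum>j<d. (cmod (\<alpha> j))\<^sup>2 * (\<Sum>k<d. (cmod (\<beta> ((k + j) mod d)))\<^sup>2))"
    by (simp add: sum_distrib_left add.commute)
  also have "\<dots> = (\<Sum>j<d. (cmod (\<alpha> j))\<^sup>2 * (\<Sum>i<d. (cmod (\<beta> i))\<^sup>2))"
    by (intro sum.cong refl arg_cong2[where f = "(*)"]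
        sum.reindex_bij_betw[OF bij_betw_cyclic_shift])
  finally show ?thesis by (simp add: sum_distrib_right)
qed

text \<open>
  The mean of the \<open>d\<^sup>2\<close> absolute values is at most their quadratic mean \<open>\<parallel>\<alpha>\<parallel> \<parallel>\<beta>\<parallel> / \<surd>d\<close>. The
  geometric mean of \<open>\<parallel>\<alpha>\<parallel>\<^sup>2\<close> and \<open>\<parallel>\<beta>\<parallel>\<^sup>2\<close> is replaced by the arithmetic one, because that can be
  summed over pairs of neighbours separately in each variable.
\<close>

lemma sum_weyl_coeff_le:
  "(\<Sum>(k, l)\<in>{..<d} \<times> {..<d}. cmod (weyl_coeff d k l \<alpha> \<beta>))
    \<le> real d * sqrt (real d) * (((\<Sum>j<d. (cmod (\<alpha> j))\<^sup>2) + (\<Sum>j<d. (cmod (\<beta> j))\<^sup>2)) / 2)"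
proof -
  let ?I = "{..<d} \<times> {..<d}" and ?c = "\<lambda>p. cmod (weyl_coeff d (fst p) (snd p) \<alpha> \<beta>)"
  define A where "A = (\<Sum>j<d. (cmod (\<alpha> j))\<^sup>2)"
  define B where "B = (\<Sum>j<d. (cmod (\<beta> j))\<^sup>2)"
  have "A \<ge> 0" "B \<ge> 0" by (simp_all add: A_def B_def sum_nonneg)
  have sq: "(\<Sum>p\<in>?I. (?c p)\<^sup>2) = real d * (A * B)"
    using sum_weyl_coeff_sq[of d \<alpha> \<beta>]
    by (simp add: A_def B_def sum.cartesian_product case_prod_beta)
  have "(\<Sum>p\<in>?I. ?c p * 1)\<^sup>2 \<le> (\<Sum>p\<in>?I. (?c p)\<^sup>2) * (\<Sum>p\<in>?I. 1\<^sup>2)"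
    by (rule Cauchy_Schwarz_ineq_sum)
  also have "\<dots> = (real d)\<^sup>2 * real d * (A * B)"
    by (simp only: sq) (simp add: power2_eq_square)
  also have "\<dots> \<le> (real d)\<^sup>2 * real d * ((A + B) / 2)\<^sup>2"
  proof (rule mult_left_mono)
    have "0 \<le> (A - B)\<^sup>2" by simp
    then show "A * B \<le> ((A + B) / 2)\<^sup>2"
      by (simp add: power2_eq_square field_simps)
  qed simp
  also have "\<dots> = (real d * sqrt (real d) * ((A + B) / 2))\<^sup>2"
    by (simp add: power_mult_distrib power_divide)
  finally have "(\<Sum>p\<in>?I. ?c p * 1) \<le> real d * sqrt (real d) * ((A + B) / 2)"
    by (rule power2_le_imp_le) (use \<open>A \<ge> 0\<close> \<open>B \<ge> 0\<close> in simp)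
  then show ?thesis by (simp add: A_def B_def case_prod_beta)
qed

section \<open>Sums over neighbours\<close>

lemma has_sum_sum:
  fixes f :: "'i \<Rightarrow> 'x \<Rightarrow> 'b :: topological_comm_monoid_add"
  assumes "\<And>i. i \<in> I \<Longrightarrow> (f i has_sum s i) A"
  shows "((\<lambda>x. \<Sum>i\<in>I. f i x) has_sum (\<Sum>i\<in>I. s i)) A"
  using assms by (induction I rule: infinite_finite_induct) (auto intro: has_sum_add)

text \<open>
  Each point occurs in at most \<open>N\<close> of the pairs in either position: it has at most \<open>N\<close> neighbours,
  and being a neighbour is a symmetric relation.
\<close>

lemma sum_neighbours_le:
  fixes h :: "'a::metric_space \<Rightarrow> real"
  assumes ball: "\<And>x::'a. finite (cball x r) \<and> card (cball x r) \<le> N"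
    and h: "\<And>x. 0 \<le> h x" "h summable_on UNIV" and F: "finite F"
  shows "(\<Sum>y\<in>F. \<Sum>x\<in>cball y r. h x + h y) \<le> 2 * real N * infsum h UNIV"
proof -
  have sum_le: "sum h G \<le> infsum h UNIV" if "finite G" for G
    using that h by (intro finite_sum_le_infsum) auto
  define G where "G = (\<Union>y\<in>F. cball y r)"
  have G: "finite G" using F by (auto simp: G_def ball)
  have "cball y r = {x. x \<in> G \<and> y \<in> cball x r}" if "y \<in> F" for y
    using that by (auto simp: G_def dist_commute)
  then have "(\<Sum>y\<in>F. \<Sum>x\<in>cball y r. h x) = (\<Sum>y\<in>F. \<Sum>x | x \<in> G \<and> y \<in> cball x r. h x)"
    by (intro sum.cong refl)
  also have "\<dots> = (\<Sum>x\<in>G. \<Sum>y | y \<in> F \<and> y \<in> cball x r. h x)"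
    using F G by (rule sum.swap_restrict)
  also have "\<dots> \<le> (\<Sum>x\<in>G. real N * h x)"
  proof (rule sum_mono)
    fix x assume "x \<in> G"
    have "card {y. y \<in> F \<and> y \<in> cball x r} \<le> card (cball x r)"
      using ball by (intro card_mono) auto
    then show "(\<Sum>y | y \<in> F \<and> y \<in> cball x r. h x) \<le> real N * h x"
      using ball[of x] h(1)[of x] by (auto intro!: mult_right_mono)
  qed
  also have "\<dots> \<le> real N * infsum h UNIV"
    using sum_le[OF G] by (simp add: mult_left_mono flip: sum_distrib_left)
  finally have 1: "(\<Sum>y\<in>F. \<Sum>x\<in>cball y r. h x) \<le> real N * infsum h UNIV" .
  have "(\<Sum>y\<in>F. \<Sum>x\<in>cball y r. h y) \<le> (\<Sum>y\<in>F. real N * h y)"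
    using ball h(1) by (intro sum_mono) (auto intro!: mult_right_mono)
  also have "\<dots> \<le> real N * infsum h UNIV"
    using sum_le[OF F] by (simp add: mult_left_mono flip: sum_distrib_left)
  finally show ?thesis using 1 by (simp add: sum.distrib)
qed

text \<open>
  The contribution of the row \<open>y\<close> to the sum of the coefficients over all pairs at distance at most
  \<open>r\<close>.
\<close>

definition local_mass ::
  "real \<Rightarrow> nat \<Rightarrow> nat \<Rightarrow> nat \<Rightarrow> (nat \<Rightarrow> 'a::metric_space ell2) \<Rightarrow> 'a \<Rightarrow> real" where
  "local_mass r d k l \<xi> y =
     (\<Sum>x\<in>cball y r. cmod (weyl_coeff d k l (\<lambda>j. Rep_ell2 (\<xi> j) x) (\<lambda>j. Rep_ell2 (\<xi> j) y)))"

text \<open>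
  The mean over \<open>k\<close> and \<open>l\<close> of the total mass is at most \<open>N \<surd>d\<close>, since the squared coordinates of
  the \<open>d\<close> unit vectors add up to \<open>d\<close>; hence some \<open>k\<close> and \<open>l\<close> do not exceed the mean. The total
  is expressed through its finite partial sums, with \<open>k\<close> and \<open>l\<close> the same for all of them.
\<close>

lemma exists_delocalised_weyl:
  fixes \<xi> :: "nat \<Rightarrow> 'a::metric_space ell2"
  assumes ball: "\<And>x::'a. finite (cball x r) \<and> card (cball x r) \<le> N"
    and unit: "\<And>j. j < d \<Longrightarrow> norm (\<xi> j) = 1" and "d > 0"
  shows "\<exists>k<d. \<exists>l<d. \<forall>F. finite F \<longrightarrow> (\<Sum>y\<in>F. local_mass r d k l \<xi> y) \<le> real N * sqrt (real d)"
proof -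
  let ?I = "{..<d} \<times> {..<d}"
  define m where "m = (\<lambda>p. local_mass r d (fst p) (snd p) \<xi>)"
  define h where "h x = (\<Sum>j<d. (cmod (Rep_ell2 (\<xi> j) x))\<^sup>2)" for x
  have h0: "0 \<le> h x" for x by (simp add: h_def sum_nonneg)
  have hsum: "(h has_sum real d) UNIV"
  proof -
    have "(h has_sum (\<Sum>j<d. (norm (\<xi> j))\<^sup>2)) UNIV"
      unfolding h_def norm_ell2_sq
      by (intro has_sum_sum has_sum_infsum summable_ell2) 
    then show ?thesis using unit by simp
  qed
  have total: "(\<Sum>p\<in>?I. \<Sum>y\<in>F. m p y) \<le> real d * real d * (real N * sqrt (real d))"
    if F: "finite F" for F
  proof -
    have "(\<Sum>p\<in>?I. \<Sum>y\<in>F. m p y) = (\<Sum>y\<in>F. \<Sum>x\<in>cball y r. \<Sum>(k, l)\<in>?I.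
        cmod (weyl_coeff d k l (\<lambda>j. Rep_ell2 (\<xi> j) x) (\<lambda>j. Rep_ell2 (\<xi> j) y)))"
      unfolding m_def local_mass_def case_prod_beta
      by (subst sum.swap, rule sum.cong[OF refl], rule sum.swap)
    also have "\<dots> \<le> (\<Sum>y\<in>F. \<Sum>x\<in>cball y r. real d * sqrt (real d) * ((h x + h y) / 2))"
      unfolding h_def by (intro sum_mono sum_weyl_coeff_le)
    also have "\<dots> = real d * sqrt (real d) / 2 * (\<Sum>y\<in>F. \<Sum>x\<in>cball y r. h x + h y)"
      by (simp only: sum_distrib_left times_divide_eq_left times_divide_eq_right)
    also have "\<dots> \<le> real d * sqrt (real d) / 2 * (2 * real N * infsum h UNIV)"
      using hsum F by (intro mult_left_mono sum_neighbours_le[OF ball] h0)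
        (auto simp: summable_on_def)
    also have "infsum h UNIV = real d" using hsum by (rule infsumI)
    finally show ?thesis by (simp add: mult_ac)
  qed
  have m0: "0 \<le> m p y" for p y by (simp add: m_def local_mass_def sum_nonneg)
  have "\<exists>p\<in>?I. \<forall>F. finite F \<longrightarrow> (\<Sum>y\<in>F. m p y) \<le> real N * sqrt (real d)"
  proof (rule ccontr)
    assume "\<not> ?thesis"
    then obtain F where F: "\<And>p. p \<in> ?I \<Longrightarrow> finite (F p)"
        "\<And>p. p \<in> ?I \<Longrightarrow> (\<Sum>y\<in>F p. m p y) > real N * sqrt (real d)"
      by (metis linorder_not_le)
    \<comment> \<open>There are only finitely many pairs \<open>p\<close>, so one finite set witnesses all their failures.\<close>
    let ?G = "\<Union>p\<in>?I. F p"
    have G: "finite ?G" using F(1) by auto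
    have "(\<Sum>p\<in>?I. real N * sqrt (real d)) < (\<Sum>p\<in>?I. \<Sum>y\<in>?G. m p y)"
    proof (rule sum_strict_mono)
      fix p assume p: "p \<in> ?I"
      have "(\<Sum>y\<in>F p. m p y) \<le> (\<Sum>y\<in>?G. m p y)"
        using p G m0 by (intro sum_mono2) auto
      then show "real N * sqrt (real d) < (\<Sum>y\<in>?G. m p y)" using F(2)[OF p] by linarith
    qed (use \<open>d > 0\<close> in auto)
    then show False using total[OF G] by simp
  qed
  then show ?thesis by (auto simp: m_def)
qed

section \<open>Operators of finite propagation\<close>

lemma propagation_le_mono: "r \<le> s \<Longrightarrow> propagation_le r \<subseteq> propagation_le s"
  by (auto simp: propagation_le_def)

lemma norm_delta [simp]: "norm (delta x) = 1"
  by (simp add: norm_ell2_def cinner_delta_right delta.rep_eq)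

lemma Rep_propagation_le:
  fixes w :: "'a::metric_space ell2 \<Rightarrow>\<^sub>L 'a ell2"
  assumes w: "w \<in> propagation_le r" and fin: "finite (cball y r)"
  shows "Rep_ell2 (blinfun_apply w \<xi>) y
    = (\<Sum>x\<in>cball y r. Rep_ell2 (blinfun_apply w (delta x)) y * Rep_ell2 \<xi> x)"
proof -
  have "bounded_linear (\<lambda>\<xi>. cinner (blinfun_apply w \<xi>) (delta y))"
    by (rule bounded_linear_compose[OF bounded_linear_cinner_left blinfun.bounded_linear_right])
  from has_sum_bounded_linear[OF this ell2_has_sum_delta[of \<xi>]]
  have "((\<lambda>x. Rep_ell2 (blinfun_apply w (delta x)) y * Rep_ell2 \<xi> x) has_sum
      Rep_ell2 (blinfun_apply w \<xi>) y) UNIV"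
    using w by (simp add: propagation_le_def bounded_ops_def scaleC.rep_eq cinner_delta_right mult.commute)
  moreover have "Rep_ell2 (blinfun_apply w (delta x)) y = 0" if "x \<notin> cball y r" for x
    using w that by (auto simp: propagation_le_def cinner_delta_right dist_commute)
  ultimately have "((\<lambda>x. Rep_ell2 (blinfun_apply w (delta x)) y * Rep_ell2 \<xi> x) has_sum
      Rep_ell2 (blinfun_apply w \<xi>) y) (cball y r)"
    by (subst has_sum_cong_neutral[where T = UNIV and g = "\<lambda>x. Rep_ell2 (blinfun_apply w (delta x)) y * Rep_ell2 \<xi> x"]) auto
  then show ?thesis using fin by (metis has_sum_finite_iff)
qed

text \<open>
  Expanding the pairing in coordinates, the entry of \<open>w\<close> at a pair \<open>(x, y)\<close> is multiplied by the
  coefficient of the Weyl matrix at \<open>(x, y)\<close>. The entries are bounded by \<open>\<parallel>w\<parallel>\<close> and vanish at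
  distance greater than \<open>r\<close>, which leaves exactly the local masses.
\<close>

lemma finite_propagation_pairing_le:
  fixes w :: "'a::metric_space ell2 \<Rightarrow>\<^sub>L 'a ell2"
  assumes w: "w \<in> propagation_le r" and fin: "\<And>y::'a. finite (cball y r)"
    and S: "\<And>F. finite F \<Longrightarrow> (\<Sum>y\<in>F. local_mass r d k l \<xi> y) \<le> S"
  shows "cmod (\<Sum>j<d. cinner (blinfun_apply w (\<xi> j)) (scaleC (phase d l j) (\<xi> ((j + k) mod d))))
    \<le> norm w * S"
proof -
  let ?\<zeta> = "\<lambda>j. scaleC (phase d l j) (\<xi> ((j + k) mod d))"
  let ?f = "\<lambda>y. \<Sum>j<d. Rep_ell2 (blinfun_apply w (\<xi> j)) y * cnj (Rep_ell2 (?\<zeta> j) y)"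
  have sums: "(?f has_sum (\<Sum>j<d. cinner (blinfun_apply w (\<xi> j)) (?\<zeta> j))) UNIV"
  proof (rule has_sum_sum)
    fix j
    show "((\<lambda>y. Rep_ell2 (blinfun_apply w (\<xi> j)) y * cnj (Rep_ell2 (?\<zeta> j) y)) has_sum
        cinner (blinfun_apply w (\<xi> j)) (?\<zeta> j)) UNIV"
      unfolding cinner.rep_eq
      by (intro has_sum_infsum square_summable_product) (use Rep_ell2 in auto)
  qed
  have entry: "cmod (Rep_ell2 (blinfun_apply w (delta x)) y) \<le> norm w" for x y
    using coord_le_norm_ell2[of "blinfun_apply w (delta x)" y] norm_blinfun[of w "delta x"]
    by simp
  have f_le: "cmod (?f y) \<le> norm w * local_mass r d k l \<xi> y" for y
  proof -
    have w_\<xi>: "Rep_ell2 (blinfun_apply w (\<xi> j)) y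
        = (\<Sum>x\<in>cball y r. Rep_ell2 (blinfun_apply w (delta x)) y * Rep_ell2 (\<xi> j) x)" for j
      by (rule Rep_propagation_le[OF w fin])
    have "?f y = (\<Sum>j<d. \<Sum>x\<in>cball y r. Rep_ell2 (blinfun_apply w (delta x)) y *
        (Rep_ell2 (\<xi> j) x * cnj (phase d l j * Rep_ell2 (\<xi> ((j + k) mod d)) y)))"
      by (simp only: w_\<xi> scaleC.rep_eq sum_distrib_right mult.assoc)
    also have "\<dots> = (\<Sum>x\<in>cball y r. Rep_ell2 (blinfun_apply w (delta x)) y *
        weyl_coeff d k l (\<lambda>j. Rep_ell2 (\<xi> j) x) (\<lambda>j. Rep_ell2 (\<xi> j) y))"
      by (subst sum.swap) (simp add: weyl_coeff_def sum_distrib_left)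
    finally have "cmod (?f y) \<le> (\<Sum>x\<in>cball y r. cmod (Rep_ell2 (blinfun_apply w (delta x)) y *
        weyl_coeff d k l (\<lambda>j. Rep_ell2 (\<xi> j) x) (\<lambda>j. Rep_ell2 (\<xi> j) y)))"
      by (simp only: norm_sum)
    also have "\<dots> \<le> norm w * local_mass r d k l \<xi> y"
      unfolding local_mass_def sum_distrib_left norm_mult
      by (intro sum_mono mult_right_mono entry) simp
    finally show ?thesis .
  qed
  have "norm (sum ?f F) \<le> norm w * S" if "finite F" for F
  proof -
    have "norm (sum ?f F) \<le> (\<Sum>y\<in>F. norm w * local_mass r d k l \<xi> y)"
      by (intro sum_norm_le f_le)
    also have "\<dots> \<le> norm w * S"
      using S[OF that] by (simp add: mult_left_mono flip: sum_distrib_left)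
    finally show ?thesis .
  qed
  then show ?thesis
    using sums unfolding has_sum_def
    by (intro tendsto_upperbound[OF tendsto_norm])
       (auto intro: eventually_finite_subsets_at_top_weakI)
qed

section \<open>Matrix units and Weyl matrices in the product\<close>

lemma vec_norm2_sq: "(vec_norm2 v)\<^sup>2 = (\<Sum>i<dim_vec v. (cmod (v $ i))\<^sup>2)"
proof -
  have "Re (v \<bullet>c v) = (\<Sum>i<dim_vec v. (cmod (v $ i))\<^sup>2)"
    by (simp add: scalar_prod_def lessThan_atLeast0 cmod_power2 flip: power2_eq_square)
  then show ?thesis by (simp add: vec_norm2_def sum_nonneg)
qed

lemma vec_norm2_nonneg: "0 \<le> vec_norm2 v"
  using vec_norm2_sq[of v] by (simp add: vec_norm2_def scalar_prod_def sum_nonneg)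

text \<open>
  A Weyl matrix permutes the coordinates of a vector and multiplies them by phases, so it is
  isometric. The bound is uniform in \<open>d\<close>, which puts arbitrary sequences of Weyl matrices into the
  product.
\<close>

lemma mat_opnorm_weyl_le:
  assumes "d > 0"
  shows "mat_opnorm (weyl d k l) \<le> 1"
  unfolding mat_opnorm_def
proof (rule cSUP_least)
  have "vec_norm2 (0\<^sub>v d) = 0" by (simp add: vec_norm2_def)
  then show "{v \<in> carrier_vec (dim_col (weyl d k l)). vec_norm2 v \<le> 1} \<noteq> {}"
    by (auto simp: weyl_def intro!: exI[of _ "0\<^sub>v d"])
next
  fix v assume "v \<in> {v \<in> carrier_vec (dim_col (weyl d k l)). vec_norm2 v \<le> 1}"
  then have v: "v \<in> carrier_vec d" "vec_norm2 v \<le> 1" by (auto simp: weyl_def)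
  let ?s = "\<lambda>j. (j + k) mod d"
  have "(vec_norm2 (weyl d k l *\<^sub>v v))\<^sup>2 = (\<Sum>i<d. (cmod ((weyl d k l *\<^sub>v v) $ i))\<^sup>2)"
    by (simp add: vec_norm2_sq weyl_def)
  also have "\<dots> = (\<Sum>j<d. (cmod ((weyl d k l *\<^sub>v v) $ ?s j))\<^sup>2)"
    by (rule sum.reindex_bij_betw[OF bij_betw_cyclic_shift, symmetric])
  also have "\<dots> = (\<Sum>j<d. (cmod (v $ j))\<^sup>2)"
  proof (rule sum.cong[OF refl])
    fix j assume j: "j \<in> {..<d}"
    have "(weyl d k l *\<^sub>v v) $ ?s j = (\<Sum>i<d. (if ?s j = ?s i then phase d l i else 0) * v $ i)"
      using v(1) j by (auto simp: weyl_def scalar_prod_def lessThan_atLeast0 intro!: sum.cong)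
    also have "\<dots> = (\<Sum>i<d. if i = j then phase d l i * v $ i else 0)"
      using bij_betw_imp_inj_on[OF bij_betw_cyclic_shift[of k d]] j
      by (intro sum.cong) (auto dest: inj_onD)
    also have "\<dots> = phase d l j * v $ j" using j by simp
    finally show "(cmod ((weyl d k l *\<^sub>v v) $ ?s j))\<^sup>2 = (cmod (v $ j))\<^sup>2"
      by (simp add: norm_mult)
  qed
  also have "\<dots> = (vec_norm2 v)\<^sup>2" using v(1) by (simp add: vec_norm2_sq)
  finally have "vec_norm2 (weyl d k l *\<^sub>v v) = vec_norm2 v"
    by (simp add: power2_eq_iff_nonneg vec_norm2_nonneg)
  then show "vec_norm2 (weyl d k l *\<^sub>v v) \<le> 1" using v(2) by simp
qed

lemma weyl_sequence_in_matrix_product: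
  "(\<lambda>n. weyl (Suc n) (K n) (L n)) \<in> carrier matrix_product"
proof -
  have "weyl (Suc n) (K n) (L n) \<in> carrier_mat (Suc n) (Suc n)" for n
    by (simp add: weyl_def)
  then show ?thesis
    by (auto simp: matrix_product_def intro!: bdd_aboveI2[where M = 1] mat_opnorm_weyl_le)
qed

definition matrix_unit :: "nat \<Rightarrow> nat \<Rightarrow> nat \<Rightarrow> nat \<Rightarrow> complex mat" where
  "matrix_unit n i j m = mat (Suc m) (Suc m) (\<lambda>(p, q). if m = n \<and> p = i \<and> q = j then 1 else 0)"

lemma matrix_unit_in_matrix_product: "matrix_unit n i j \<in> carrier matrix_product"
proof -
  have "mat_opnorm (matrix_unit n i j m) = mat_opnorm (0\<^sub>m (Suc m) (Suc m))" if "m \<noteq> n" for m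
    using that by (intro arg_cong[where f = mat_opnorm]) (auto simp: matrix_unit_def)
  moreover have "mat_opnorm (0\<^sub>m (Suc m) (Suc m)) \<le> 0" for m
    unfolding mat_opnorm_def
    by (rule cSUP_least)
       (auto simp: vec_norm2_def scalar_prod_def intro!: exI[of _ "0\<^sub>v (Suc m)"])
  ultimately have "mat_opnorm (matrix_unit n i j m) \<le> max 0 (mat_opnorm (matrix_unit n i j n))" for m
    by (cases "m = n") (auto simp: max.coboundedI1)
  then have "bdd_above (range (\<lambda>m. mat_opnorm (matrix_unit n i j m)))"
    by (rule bdd_aboveI2)
  moreover have "matrix_unit n i j m \<in> carrier_mat (Suc m) (Suc m)" for m
    by (simp add: matrix_unit_def)
  ultimately show ?thesis by (simp add: matrix_product_def)
qed

lemma mat_adjoint_index: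
  "i < dim_col A \<Longrightarrow> j < dim_row A \<Longrightarrow> mat_adjoint A $$ (i, j) = cnj (A $$ (j, i))"
  by (simp add: mat_adjoint_def mat_of_rows_def)

lemma matrix_unit_adjoint_mult:
  assumes "i \<le> n"
  shows "alg_mult matrix_product (alg_star matrix_product (matrix_unit n i j)) (matrix_unit n i j)
    = matrix_unit n j j"
proof
  fix m
  have unit_dims: "dim_row (matrix_unit n i j m) = Suc m" "dim_col (matrix_unit n i j m) = Suc m"
    by (simp_all add: matrix_unit_def)
  have dims: "dim_row (mat_adjoint (matrix_unit n i j m)) = Suc m"
    "dim_col (mat_adjoint (matrix_unit n i j m)) = Suc m"
    by (simp_all add: mat_adjoint_def mat_of_rows_def matrix_unit_def)
  have "mat_adjoint (matrix_unit n i j m) * matrix_unit n i j m = matrix_unit n j j m"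
  proof (rule eq_matI)
    fix p q assume "p < dim_row (matrix_unit n j j m)" "q < dim_col (matrix_unit n j j m)"
    then have pq: "p < Suc m" "q < Suc m" by (simp_all add: matrix_unit_def)
    then have "(mat_adjoint (matrix_unit n i j m) * matrix_unit n i j m) $$ (p, q)
        = (\<Sum>s\<in>{0..<Suc m}. mat_adjoint (matrix_unit n i j m) $$ (p, s) * matrix_unit n i j m $$ (s, q))"
      by (simp add: scalar_prod_def dims unit_dims del: sum.op_ivl_Suc)
    also have "\<dots> = (\<Sum>s\<in>{0..<Suc m}. if s = i then (if m = n \<and> p = j \<and> q = j then 1 else 0) else 0)"
      using pq by (intro sum.cong refl) (simp add: mat_adjoint_index unit_dims, simp add: matrix_unit_def)
    also have "\<dots> = matrix_unit n j j m $$ (p, q)"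
      using pq assms by (auto simp: matrix_unit_def)
    finally show "(mat_adjoint (matrix_unit n i j m) * matrix_unit n i j m) $$ (p, q)
      = matrix_unit n j j m $$ (p, q)" .
  qed (simp_all add: dims, simp_all add: matrix_unit_def)
  then show "alg_mult matrix_product (alg_star matrix_product (matrix_unit n i j)) (matrix_unit n i j) m
    = matrix_unit n j j m"
    by (simp add: matrix_product_def)
qed

lemma weyl_mult_matrix_unit:
  assumes "j \<le> n"
  shows "alg_mult matrix_product (\<lambda>m. weyl (Suc m) (K m) (L m)) (matrix_unit n j 0)
    = alg_scale matrix_product (phase (Suc n) (L n) j) (matrix_unit n ((j + K n) mod Suc n) 0)"
proof
  fix m
  let ?W = "weyl (Suc m) (K m) (L m)" and ?i = "(j + K n) mod Suc n"
  have "?W * matrix_unit n j 0 m = phase (Suc n) (L n) j \<cdot>\<^sub>m matrix_unit n ?i 0 m"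
  proof (rule eq_matI)
    fix p q assume "p < dim_row (phase (Suc n) (L n) j \<cdot>\<^sub>m matrix_unit n ?i 0 m)"
      "q < dim_col (phase (Suc n) (L n) j \<cdot>\<^sub>m matrix_unit n ?i 0 m)"
    then have pq: "p < Suc m" "q < Suc m" by (simp_all add: matrix_unit_def)
    then have "(?W * matrix_unit n j 0 m) $$ (p, q)
        = (\<Sum>s\<in>{0..<Suc m}. ?W $$ (p, s) * matrix_unit n j 0 m $$ (s, q))"
      by (simp add: scalar_prod_def weyl_def matrix_unit_def)
    also have "\<dots> = (\<Sum>s\<in>{0..<Suc m}. if s = j then (if m = n \<and> q = 0 then ?W $$ (p, j) else 0) else 0)"
      using pq by (intro sum.cong) (auto simp: matrix_unit_def)
    also have "\<dots> = (phase (Suc n) (L n) j \<cdot>\<^sub>m matrix_unit n ?i 0 m) $$ (p, q)"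
      using pq assms by (auto simp: matrix_unit_def weyl_def)
    finally show "(?W * matrix_unit n j 0 m) $$ (p, q)
      = (phase (Suc n) (L n) j \<cdot>\<^sub>m matrix_unit n ?i 0 m) $$ (p, q)" .
  qed (simp_all add: weyl_def matrix_unit_def)
  then show "alg_mult matrix_product (\<lambda>m. weyl (Suc m) (K m) (L m)) (matrix_unit n j 0) m
    = alg_scale matrix_product (phase (Suc n) (L n) j) (matrix_unit n ?i 0) m"
    by (simp add: matrix_product_def)
qed

section \<open>Vectors carrying the matrix blocks\<close>

text \<open>
  Choose \<open>\<eta>\<close> such that the image of the matrix unit \<open>e\<^sub>0\<^sub>0\<close> of the \<open>n\<close>-th block maps it to a unit vector,
  and let \<open>\<xi>\<^sub>j\<close> be the image of \<open>\<eta>\<close> under \<open>\<phi>(e\<^sub>j\<^sub>0)\<close>. Since \<open>e\<^sub>j\<^sub>0\<^sup>* e\<^sub>j\<^sub>0 = e\<^sub>0\<^sub>0\<close>, all \<open>\<xi>\<^sub>j\<close>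
  have the same norm. A sequence of Weyl matrices acts on them through its \<open>n\<close>-th entry only,
  because \<open>e\<^sub>j\<^sub>0\<close> annihilates all other blocks.
\<close>

lemma star_embedding_block_vectors:
  fixes \<phi> :: "(nat \<Rightarrow> complex mat) \<Rightarrow> ('a::metric_space ell2 \<Rightarrow>\<^sub>L 'a ell2)"
  assumes "star_embedding matrix_product uniform_Roe_algebra \<phi>"
  shows "\<exists>\<xi>. (\<forall>j\<le>n. norm (\<xi> j) = 1) \<and>
    (\<forall>K L. \<forall>j\<le>n. blinfun_apply (\<phi> (\<lambda>m. weyl (Suc m) (K m) (L m))) (\<xi> j)
      = scaleC (phase (Suc n) (L n) j) (\<xi> ((j + K n) mod Suc n)))"
proof -
  let ?M = "carrier matrix_product"
  have inj: "inj_on \<phi> ?M" and ops: "\<And>a. a \<in> ?M \<Longrightarrow> \<phi> a \<in> bounded_ops"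
    using assms uniform_Roe_algebra_subset by (auto simp: star_embedding_def star_hom_def)
  have scale: "\<phi> (alg_scale matrix_product c a) = scaleC_op c (\<phi> a)"
    and mult: "b \<in> ?M \<Longrightarrow> \<phi> (alg_mult matrix_product a b) = \<phi> a o\<^sub>L \<phi> b"
    and star: "\<phi> (alg_star matrix_product a) = adj (\<phi> a)" if "a \<in> ?M" for a b c
    using assms that by (auto simp: star_embedding_def star_hom_def uniform_Roe_algebra_def)
  note E = matrix_unit_in_matrix_product
  have star_in: "alg_star matrix_product (matrix_unit n i j) \<in> ?M" for i j
  proof -
    have "alg_star matrix_product (matrix_unit n i j) = matrix_unit n j i"
      by (auto simp: matrix_product_def mat_adjoint_index fun_eq_iff
          mat_adjoint_def mat_of_rows_def matrix_unit_def intro!: eq_matI)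
    then show ?thesis by (simp add: E)
  qed
  have "\<phi> (matrix_unit n 0 0) \<noteq> 0"
  proof
    assume 0: "\<phi> (matrix_unit n 0 0) = 0"
    \<comment> \<open>The row index \<open>Suc n\<close> is out of range, so this matrix unit is the zero sequence.\<close>
    have Z: "alg_scale matrix_product 0 (matrix_unit n 0 0) = matrix_unit n (Suc n) 0"
      by (auto simp: matrix_product_def matrix_unit_def fun_eq_iff intro!: eq_matI)
    have "\<phi> (matrix_unit n (Suc n) 0) = scaleC_op 0 (\<phi> (matrix_unit n 0 0))"
      unfolding Z[symmetric] by (rule scale[OF E])
    also have "\<dots> = \<phi> (matrix_unit n 0 0)"
      unfolding 0 by (rule blinfun_eqI) (simp add: scaleC_op_apply norm_scaleC flip: norm_eq_zero)
    finally have "matrix_unit n (Suc n) 0 = matrix_unit n 0 0"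
      using inj E by (auto dest: inj_onD)
    then have "matrix_unit n (Suc n) 0 n $$ (0, 0) = matrix_unit n 0 0 n $$ (0, 0)" by simp
    then show False by (simp add: matrix_unit_def)
  qed
  then obtain \<theta> where \<theta>: "blinfun_apply (\<phi> (matrix_unit n 0 0)) \<theta> \<noteq> 0"
    by (metis blinfun_eqI zero_blinfun.rep_eq)
  define \<eta> where "\<eta> = \<theta> /\<^sub>R norm (blinfun_apply (\<phi> (matrix_unit n 0 0)) \<theta>)"
  define \<xi> where "\<xi> j = blinfun_apply (\<phi> (matrix_unit n j 0)) \<eta>" for j
  have norm_\<xi>: "norm (\<xi> j) = sqrt (Re (cinner \<eta> (\<xi> 0)))" if "j \<le> n" for j
  proof -
    have "cinner (\<xi> j) (\<xi> j) = cinner \<eta> (blinfun_apply (adj (\<phi> (matrix_unit n j 0))) (\<xi> j))"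
      unfolding \<xi>_def by (rule adj(2)[OF ops[OF E]])
    also have "blinfun_apply (adj (\<phi> (matrix_unit n j 0))) (\<xi> j)
        = blinfun_apply (\<phi> (alg_mult matrix_product
            (alg_star matrix_product (matrix_unit n j 0)) (matrix_unit n j 0))) \<eta>"
      by (simp add: mult[OF star_in E] star[OF E] \<xi>_def)
    also have "\<dots> = \<xi> 0" by (simp add: matrix_unit_adjoint_mult[OF that] \<xi>_def)
    finally show ?thesis by (simp add: norm_ell2_def)
  qed
  have "norm (\<xi> 0) = 1" using \<theta> by (simp add: \<xi>_def \<eta>_def blinfun.scaleR_right)
  then have unit: "norm (\<xi> j) = 1" if "j \<le> n" for j
    using norm_\<xi>[OF that] norm_\<xi>[of 0] by simp
  have weyl: "blinfun_apply (\<phi> (\<lambda>m. weyl (Suc m) (K m) (L m))) (\<xi> j)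
      = scaleC (phase (Suc n) (L n) j) (\<xi> ((j + K n) mod Suc n))" if "j \<le> n" for K L j
  proof -
    have "blinfun_apply (\<phi> (\<lambda>m. weyl (Suc m) (K m) (L m))) (\<xi> j)
        = blinfun_apply (\<phi> (alg_mult matrix_product
            (\<lambda>m. weyl (Suc m) (K m) (L m)) (matrix_unit n j 0))) \<eta>"
      by (simp add: mult[OF weyl_sequence_in_matrix_product E] \<xi>_def)
    also have "\<dots> = scaleC (phase (Suc n) (L n) j) (\<xi> ((j + K n) mod Suc n))"
      by (simp add: weyl_mult_matrix_unit[OF that] scale[OF E] scaleC_op_apply \<xi>_def)
    finally show ?thesis .
  qed
  show ?thesis using unit weyl by blast
qed

theorem theoremA:
  assumes "uniformly_locally_finite TYPE('a::metric_space)"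
  shows "\<not> (\<exists>\<phi>. star_embedding matrix_product
              (uniform_Roe_algebra :: ('a ell2 \<Rightarrow>\<^sub>L 'a ell2) star_algebra) \<phi>)"
proof
  assume "\<exists>\<phi>. star_embedding matrix_product
    (uniform_Roe_algebra :: ('a ell2 \<Rightarrow>\<^sub>L 'a ell2) star_algebra) \<phi>"
  then obtain \<phi> where \<phi>: "star_embedding matrix_product
    (uniform_Roe_algebra :: ('a ell2 \<Rightarrow>\<^sub>L 'a ell2) star_algebra) \<phi>" ..
  obtain \<xi> where unit: "\<And>n j. j \<le> n \<Longrightarrow> norm (\<xi> n j) = 1"
    and \<phi>_weyl: "\<And>n K L j. j \<le> n \<Longrightarrow> blinfun_apply (\<phi> (\<lambda>m. weyl (Suc m) (K m) (L m))) (\<xi> n j)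
      = scaleC (phase (Suc n) (L n) j) (\<xi> n ((j + K n) mod Suc n))"
    using star_embedding_block_vectors[OF \<phi>] by metis
  have "\<forall>s. \<exists>N. \<forall>x::'a. finite (cball x (real (Suc s))) \<and> card (cball x (real (Suc s))) \<le> N"
    using assms by (auto simp: uniformly_locally_finite_def)
  then obtain N where N: "\<And>s x. finite (cball (x::'a) (real (Suc s))) \<and> card (cball x (real (Suc s))) \<le> N s"
    by metis
  \<comment> \<open>The block \<open>n\<close> is prepared for the radius \<open>Suc (s n)\<close>; by the pairing function, \<open>s\<close> takes every
      value infinitely often.\<close>
  define s where "s n = fst (prod_decode n)" for n
  have "\<exists>k<Suc n. \<exists>l<Suc n. \<forall>F. finite F \<longrightarrow>
      (\<Sum>y\<in>F. local_mass (real (Suc (s n))) (Suc n) k l (\<xi> n) y) \<le> real (N (s n)) * sqrt (real (Suc n))" for n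
    using N unit by (intro exists_delocalised_weyl) auto
  then obtain K L where KL: "\<And>n F. finite F \<Longrightarrow>
      (\<Sum>y\<in>F. local_mass (real (Suc (s n))) (Suc n) (K n) (L n) (\<xi> n) y) \<le> real (N (s n)) * sqrt (real (Suc n))"
    by metis
  define a where "a = (\<lambda>m. weyl (Suc m) (K m) (L m))"
  have "\<phi> a \<in> closure (\<Union>R\<in>{0<..}. propagation_le R)"
    using \<phi> weyl_sequence_in_matrix_product[of K L]
    by (auto simp: star_embedding_def star_hom_def uniform_Roe_algebra_def a_def)
  then have "\<exists>w\<in>\<Union>R\<in>{0<..}. propagation_le R. dist w (\<phi> a) < 1 / 2"
    by (rule closure_approachable[THEN iffD1, rule_format]) simp
  then obtain w where "w \<in> (\<Union>R\<in>{0<..}. propagation_le R)" and close: "dist w (\<phi> a) < 1 / 2"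
    by blast
  then obtain R where w: "w \<in> propagation_le R" by blast
  obtain t :: nat where "R \<le> real t" using real_arch_simple by blast
  then have wt: "w \<in> propagation_le (real (Suc t))"
    using w propagation_le_mono[of R "real (Suc t)"] by auto
  \<comment> \<open>A block prepared for a radius that bounds the propagation of \<open>w\<close>, of size at least \<open>M\<close>: large
      enough for \<open>d/2 > \<parallel>w\<parallel> N \<surd>d\<close>.\<close>
  obtain M :: nat where M: "(2 * norm w * real (N t))\<^sup>2 < real M"
    using reals_Archimedean2 by blast
  define n where "n = prod_encode (t, M)"
  have st: "s n = t" by (simp add: s_def n_def)
  have "M \<le> n" unfolding n_def by (rule le_prod_encode_2)
  define \<zeta> where "\<zeta> j = scaleC (phase (Suc n) (L n) j) (\<xi> n ((j + K n) mod Suc n))" for j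
  have \<phi>a: "blinfun_apply (\<phi> a) (\<xi> n j) = \<zeta> j" if "j < Suc n" for j
    using that \<phi>_weyl[of j n K L] by (simp add: a_def \<zeta>_def)
  have norm_\<zeta>: "norm (\<zeta> j) = 1" for j
  proof -
    have "(j + K n) mod Suc n < Suc n" by simp
    then have "(j + K n) mod Suc n \<le> n" by linarith
    then show ?thesis by (simp add: \<zeta>_def norm_scaleC unit)
  qed
  have diff: "cmod (cinner (\<zeta> j - blinfun_apply w (\<xi> n j)) (\<zeta> j)) \<le> 1 / 2" if "j < Suc n" for j
  proof -
    have "cmod (cinner (\<zeta> j - blinfun_apply w (\<xi> n j)) (\<zeta> j)) \<le> norm (\<zeta> j - blinfun_apply w (\<xi> n j))"
      using cmod_cinner_le[of _ "\<zeta> j"] by (simp add: norm_\<zeta>)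
    also have "\<dots> = norm (blinfun_apply (\<phi> a - w) (\<xi> n j))"
      by (simp add: \<phi>a[OF that] blinfun.diff_left)
    also have "\<dots> \<le> norm (\<phi> a - w)"
      using norm_blinfun[of "\<phi> a - w" "\<xi> n j"] that by (simp add: unit)
    also have "\<dots> \<le> 1 / 2" using close by (simp add: dist_norm norm_minus_commute)
    finally show ?thesis .
  qed
  have "cinner (\<zeta> j) (\<zeta> j) = 1" for j
    using norm_\<zeta>[of j] by (simp add: norm_ell2_def cinner_self_ell2)
  then have "complex_of_real (real (Suc n)) = (\<Sum>j<Suc n. cinner (\<zeta> j) (\<zeta> j))" by simp
  also have "\<dots> = (\<Sum>j<Suc n. cinner (blinfun_apply w (\<xi> n j)) (\<zeta> j))
      + (\<Sum>j<Suc n. cinner (\<zeta> j - blinfun_apply w (\<xi> n j)) (\<zeta> j))"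
    by (simp only: add_diff_cancel_left' add_diff_eq flip: sum.distrib cinner_add_left_ell2)
  finally have eq: "complex_of_real (real (Suc n))
      = (\<Sum>j<Suc n. cinner (blinfun_apply w (\<xi> n j)) (\<zeta> j))
      + (\<Sum>j<Suc n. cinner (\<zeta> j - blinfun_apply w (\<xi> n j)) (\<zeta> j))"
    (is "_ = ?x + ?y") .
  have "real (Suc n) = cmod (complex_of_real (real (Suc n)))"
    by (simp only: norm_of_real abs_of_nat)
  also have "\<dots> = cmod (?x + ?y)" by (rule arg_cong[OF eq])
  also have "\<dots> \<le> cmod ?x + cmod ?y" by (rule norm_triangle_ineq)
  also have "\<dots> \<le> norm w * (real (N t) * sqrt (real (Suc n))) + real (Suc n) * (1 / 2)"
  proof (rule add_mono)
    show "cmod (\<Sum>j<Suc n. cinner (blinfun_apply w (\<xi> n j)) (\<zeta> j))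
        \<le> norm w * (real (N t) * sqrt (real (Suc n)))"
      unfolding \<zeta>_def using N[of _ t] KL[of _ n, unfolded st]
      by (intro finite_propagation_pairing_le[OF wt]) blast+
    show "cmod (\<Sum>j<Suc n. cinner (\<zeta> j - blinfun_apply w (\<xi> n j)) (\<zeta> j)) \<le> real (Suc n) * (1 / 2)"
      by (rule order_trans[OF sum_norm_le[where g = "\<lambda>_. 1 / 2"]]) (use diff in simp_all)
  qed
  finally have "sqrt (real (Suc n)) * sqrt (real (Suc n)) \<le> (2 * norm w * real (N t)) * sqrt (real (Suc n))"
    by (simp add: field_simps)
  then have "sqrt (real (Suc n)) \<le> 2 * norm w * real (N t)"
    by (rule mult_right_le_imp_le) simp
  then have "(sqrt (real (Suc n)))\<^sup>2 \<le> (2 * norm w * real (N t))\<^sup>2"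
    by (rule power_mono) simp
  then show False using M \<open>M \<le> n\<close> by simp
qed

end
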